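(* The inclusion $I(\mathbf{CSP})\subset\hat I(\mathbf{SP})$ holds and is proper, i.e. $I(\mathbf{CSP})\subseteq\hat I(\mathbf{SP})$ and there exists a set $E\subseteq\mathbb R^{+}$ such that $E\in\hat I(\mathbf{SP})$ but $E\notin I(\mathbf{CSP})$.
   Context: $\mathbb R^{+}=[0,\infty)$ and $\mathbb N=\{1,2,\dots\}$. For $E\subseteq\mathbb R^{+}$ and $h>0$, $\lambda(E,0,h)$ is the length of the largest open subinterval of $(0,h)$ (possibly empty) that contains no point of $E$. The set $E$ is strongly porous on the right at $0$ if $\limsup_{h\to0^{+}}\lambda(E,0,h)/h=1$; $\mathbf{SP}$ is the collection of all $E\subseteq\mathbb R^{+}$ that are strongly porous on the right at $0$. Consider sequences $\tilde h=\{h_n\}_{n\in\mathbb N}$ of positive reals with $h_n\downarrow0$ (decreasing to $0$). $\tilde E$ is the set of such sequences with $h_n\in E\setminus\{0\}$ for all $n$; $\tilde H(E)$ is the set of such sequences with $\lambda(E,0,h_n)/h_n\to1$ as $n\to\infty$. For sequences of positive numbers, $\{a_n\}\asymp\{\gamma_n\}$ means that there are constants $c_1,c_2>0$ with $c_1a_n\le\gamma_n\le c_2a_n$ for all $n$. A set $E\subseteq\mathbb R^{+}$ is completely strongly porous on the right at $0$ if for every $\tilde\tau\in\tilde E$ there is $\tilde h\in\tilde H(E)$ with $\tilde\tau\asymp\tilde h$; $\mathbf{CSP}$ is the collection of all such $E$. $I(\mathbf{CSP})$ (the ideal generated by $\mathbf{CSP}$) is the collection of all finite unions $A_1\cup\dots\cup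 A_n$, $n\in\mathbb N$, with $A_1,\dots,A_n\in\mathbf{CSP}$. A collection $I$ of subsets of $\mathbb R^{+}$ is an ideal on $\mathbb R^{+}$ if it is closed under taking subsets, closed under unions of two members, and $\mathbb R^{+}\notin I$. An ideal $I$ on $\mathbb R^{+}$ is $\mathbf{SP}$-maximal if $I\subseteq\mathbf{SP}$ and, for every ideal $J$ on $\mathbb R^{+}$, $I\subseteq J\subseteq\mathbf{SP}$ implies $I=J$. $\hat I(\mathbf{SP})$ is the intersection of all $\mathbf{SP}$-maximal ideals. *)

theory Defs
  imports "HOL-Analysis.Analysis"
begin

abbreviation nonneg_reals :: "real set" ("\<real>\<^sub>+") where
  "\<real>\<^sub>+ \<equiv> {0..}"

text \<open>
  The length of the largest open subinterval of \<open>(0, h)\<close> free of points of \<open>E\<close>.  The case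
  \<open>a = b\<close> is the empty interval.  The supremum is attained for \<open>h > 0\<close>, see \<open>max_gap_attained\<close>.
\<close>
definition max_gap :: "real set \<Rightarrow> real \<Rightarrow> real" where
  "max_gap E h = Sup {b - a | a b. 0 \<le> a \<and> a \<le> b \<and> b \<le> h \<and> {a<..<b} \<inter> E = {}}"

lemma max_gap_attained:
  assumes "h > 0"
  shows "\<exists>a b. 0 \<le> a \<and> a \<le> b \<and> b \<le> h \<and> {a<..<b} \<inter> E = {} \<and> max_gap E h = b - a
    \<and> (\<forall>a' b'. 0 \<le> a' \<and> a' \<le> b' \<and> b' \<le> h \<and> {a'<..<b'} \<inter> E = {} \<longrightarrow> b' - a' \<le> b - a)"
proof -
  define P where "P = {p :: real \<times> real. 0 \<le> fst p \<and> fst p \<le> snd p \<and> snd p \<le> h \<and>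
    (\<forall>x. x \<in> E \<longrightarrow> x \<le> fst p \<or> snd p \<le> x)}"
  have P_iff: "(a, b) \<in> P \<longleftrightarrow> 0 \<le> a \<and> a \<le> b \<and> b \<le> h \<and> {a<..<b} \<inter> E = {}" for a b
    unfolding P_def disjoint_iff greaterThanLessThan_iff fst_conv snd_conv mem_Collect_eq
    by (meson not_le)
  have gap_closed: "closed {p. x \<in> E \<longrightarrow> x \<le> fst p \<or> snd p \<le> x}" for x
  proof (cases "x \<in> E")
    case True
    have "closed {p :: real \<times> real. x \<le> fst p \<or> snd p \<le> x}"
      by (intro closed_Collect_disj closed_Collect_le continuous_on_const continuous_on_fst
          continuous_on_snd continuous_on_id)
    with True show ?thesis by simp
  qed simp
  have "closed P"
    unfolding P_def
    by (intro closed_Collect_conj closed_Collect_all gap_closed closed_Collect_le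
        continuous_on_const continuous_on_fst continuous_on_snd continuous_on_id)
  moreover have "P \<subseteq> cbox (0, 0) (h, h)"
    by (auto simp: P_def cbox_Pair_eq)
  ultimately have "compact P"
    using compact_Int_closed[OF compact_cbox[of "(0, 0)" "(h, h)"], of P] by (simp add: inf.absorb2)
  moreover have "P \<noteq> {}"
    using assms P_iff[of 0 0] by auto
  moreover have "continuous_on P (\<lambda>p. snd p - fst p)"
    by (intro continuous_intros)
  ultimately obtain p where p: "p \<in> P" "\<And>q. q \<in> P \<Longrightarrow> snd q - fst q \<le> snd p - fst p"
    using continuous_attains_sup[of P "\<lambda>p. snd p - fst p"] by auto
  obtain a b where ab: "p = (a, b)"
    by (cases p)
  have le: "b' - a' \<le> b - a" if "(a', b') \<in> P" for a' b'
    using p(2)[OF that] ab by simp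
  have "max_gap E h = b - a"
    unfolding max_gap_def
  proof (rule cSup_eq_maximum)
    show "b - a \<in> {b - a | a b. 0 \<le> a \<and> a \<le> b \<and> b \<le> h \<and> {a<..<b} \<inter> E = {}}"
      using p(1) ab P_iff by blast
  next
    fix x
    assume "x \<in> {b - a | a b. 0 \<le> a \<and> a \<le> b \<and> b \<le> h \<and> {a<..<b} \<inter> E = {}}"
    then show "x \<le> b - a"
      using le P_iff by blast
  qed
  then show ?thesis
    using p(1) ab le P_iff by blast
qed

definition SP :: "real set set" where
  "SP = {E. E \<subseteq> \<real>\<^sub>+ \<and> Limsup (at_right 0) (\<lambda>h. ereal (max_gap E h / h)) = 1}"

definition decreasing_null :: "(nat \<Rightarrow> real) \<Rightarrow> bool" where
  "decreasing_null h \<longleftrightarrow> (\<forall>n. h n > 0) \<and> decseq h \<and> h \<longlonglongrightarrow> 0"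

definition seqs_in :: "real set \<Rightarrow> (nat \<Rightarrow> real) set" where
  "seqs_in E = {\<tau>. decreasing_null \<tau> \<and> (\<forall>n. \<tau> n \<in> E - {0})}"

definition gap_seqs :: "real set \<Rightarrow> (nat \<Rightarrow> real) set" where
  "gap_seqs E = {h. decreasing_null h \<and> (\<lambda>n. max_gap E (h n) / h n) \<longlonglongrightarrow> 1}"

definition seq_asymp :: "(nat \<Rightarrow> real) \<Rightarrow> (nat \<Rightarrow> real) \<Rightarrow> bool" where
  "seq_asymp a \<gamma> \<longleftrightarrow> (\<exists>c1>0. \<exists>c2>0. \<forall>n. c1 * a n \<le> \<gamma> n \<and> \<gamma> n \<le> c2 * a n)"

definition CSP :: "real set set" where
  "CSP = {E. E \<subseteq> \<real>\<^sub>+ \<and> (\<forall>\<tau>\<in>seqs_in E. \<exists>h\<in>gap_seqs E. seq_asymp \<tau> h)}"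

definition finite_unions :: "real set set \<Rightarrow> real set set" where
  "finite_unions \<A> = {E. \<exists>n\<ge>1. \<exists>A :: nat \<Rightarrow> real set. (\<forall>i\<in>{1..n}. A i \<in> \<A>) \<and> E = (\<Union>i\<in>{1..n}. A i)}"

definition I_CSP :: "real set set" where
  "I_CSP = finite_unions CSP"

definition set_ideal :: "real set set \<Rightarrow> bool" where
  "set_ideal I \<longleftrightarrow> I \<subseteq> Pow \<real>\<^sub>+ \<and> (\<forall>A\<in>I. \<forall>B. B \<subseteq> A \<longrightarrow> B \<in> I) \<and>
     (\<forall>A\<in>I. \<forall>B\<in>I. A \<union> B \<in> I) \<and> \<real>\<^sub>+ \<notin> I"

definition SP_maximal :: "real set set \<Rightarrow> bool" where
  "SP_maximal I \<longleftrightarrow> set_ideal I \<and> I \<subseteq> SP \<and> (\<forall>J. set_ideal J \<and> I \<subseteq> J \<and> J \<subseteq> SP \<longrightarrow> I = J)"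

definition I_hat_SP :: "real set set" where
  "I_hat_SP = \<Inter> {I. SP_maximal I}"

end

theory Submission
  imports Defs "HOL-Library.Nat_Bijection"
begin

text \<open>
  On a logarithmic scale, a set is in \<open>SP\<close> iff it has arbitrarily long gaps arbitrarily far out.
  Call \<open>E\<close> syndetically porous if every long enough window far out contains a gap of \<open>E\<close> of any
  prescribed length.  Such a gap can be found inside a long gap of any \<open>A \<in> SP\<close>, so
  \<open>A \<union> E \<in> SP\<close>; hence \<open>E\<close> can be adjoined to any ideal inside \<open>SP\<close> and so lies in every maximal one.
  A set in \<open>CSP\<close> consists of clusters of bounded length with distances tending to infinity, so it is
  syndetically porous.  A union of \<open>n\<close> such sets cannot contain, arbitrarily far out, translates of
  one arithmetic progression of length more than \<open>n\<close> whose difference exceeds the length of all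
  clusters.  A union of \<open>(m + 1)\<close>-term progressions of difference \<open>m\<close>, sparsely placed and each \<open>m\<close>
  occurring infinitely often, contains these but is syndetically porous: a gap of length \<open>k\<close> is
  either inside the progression (\<open>m \<ge> k\<close>) or next to it, at distance at most \<open>m\<^sup>2 < k\<^sup>2\<close>.
\<close>

section \<open>Strong porosity as gaps of prescribed ratio\<close>

lemma max_gap_ge:
  assumes "0 \<le> a" "a \<le> b" "b \<le> h" "0 < h" "{a<..<b} \<inter> E = {}"
  shows "b - a \<le> max_gap E h"
  using max_gap_attained[OF assms(4), of E] assms by fastforce

lemma max_gap_le: "0 < h \<Longrightarrow> max_gap E h \<le> h"
  using max_gap_attained[of h E] by fastforce

text \<open>A free interval filling almost all of \<open>(0, h)\<close> must start at a tiny
  fraction of \<open>h\<close>, so its endpoints have a large ratio; conversely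
  \<open>{a<..<K * a}\<close> fills the fraction \<open>1 - 1 / K\<close> of
  \<open>(0, K * a)\<close>.\<close>

lemma SP_iff:
  "E \<in> SP \<longleftrightarrow> E \<subseteq> \<real>\<^sub>+ \<and>
    (\<forall>K>1. \<forall>\<delta>>0. \<exists>a>0. K * a < \<delta> \<and> {a<..<K * a} \<inter> E = {})" (is "_ \<longleftrightarrow> _ \<and> ?gaps")
proof -
  let ?f = "\<lambda>h. ereal (max_gap E h / h)"
  have "Limsup (at_right 0) ?f = 1 \<longleftrightarrow> ?gaps"
  proof
    assume L: "Limsup (at_right 0) ?f = 1"
    show ?gaps
    proof (intro allI impI)
      fix K \<delta> :: real
      assume "K > 1" "\<delta> > 0"
      \<comment> \<open>With this value, a gap in \<open>(0, h)\<close> longer than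
        \<open>(1 - \<eta>) * h\<close> starts below \<open>\<eta> * h\<close> and ends beyond
        \<open>K * (\<eta> * h)\<close>.\<close>
      define \<eta> where "\<eta> = 1 / (K + 1)"
      have \<eta>: "0 < \<eta>" "K * \<eta> = 1 - \<eta>"
        using \<open>K > 1\<close> by (auto simp: \<eta>_def field_simps)
      have "\<not> eventually (\<lambda>h. ?f h \<le> ereal (1 - \<eta>)) (at_right 0)"
      proof
        assume "eventually (\<lambda>h. ?f h \<le> ereal (1 - \<eta>)) (at_right 0)"
        then have "Limsup (at_right 0) ?f \<le> ereal (1 - \<eta>)"
          by (rule Limsup_bounded)
        then show False
          using \<eta> by (simp add: L)
      qed
      then have "\<exists>h>0. h < \<delta> \<and> \<not> ?f h \<le> ereal (1 - \<eta>)"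
        using \<open>\<delta> > 0\<close> unfolding eventually_at_right_field by meson
      then obtain h where h: "0 < h" "h < \<delta>" "max_gap E h / h > 1 - \<eta>"
        by (simp only: ereal_less_eq not_le) blast
      then have "max_gap E h > (1 - \<eta>) * h"
        by (simp add: field_simps)
      then obtain a b where ab: "0 \<le> a" "b \<le> h" "{a<..<b} \<inter> E = {}" "b - a > (1 - \<eta>) * h"
        using max_gap_attained[OF h(1), of E] by metis
      have "K * (\<eta> * h) = (1 - \<eta>) * h"
        using \<eta>(2) by (metis mult.assoc)
      moreover have "(1 - \<eta>) * h = h - \<eta> * h"
        by (simp add: left_diff_distrib)
      moreover have "0 < \<eta> * h"
        using h \<eta> by simp
      ultimately have "0 < \<eta> * h" "a < \<eta> * h" "K * (\<eta> * h) < b" "K * (\<eta> * h) < \<delta>"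
        using ab h by linarith+
      then show "\<exists>a>0. K * a < \<delta> \<and> {a<..<K * a} \<inter> E = {}"
        using ab(3) by (intro exI[of _ "\<eta> * h"]) (auto simp: disjoint_iff)
    qed
  next
    assume gaps: ?gaps
    have "Limsup (at_right 0) ?f \<le> 1"
    proof (rule Limsup_bounded)
      have "?f h \<le> 1" if "h > 0" for h
        using max_gap_le[OF that, of E] that by simp
      then show "\<forall>\<^sub>F h in at_right 0. ?f h \<le> 1"
        by (simp only: eventually_at_right_field) (meson zero_less_one)
    qed
    moreover have "\<not> Limsup (at_right 0) ?f < 1"
    proof
      assume "Limsup (at_right 0) ?f < 1"
      then obtain c where c: "Limsup (at_right 0) ?f < ereal c" "ereal c < 1"
        using ereal_dense2 by blast
      \<comment> \<open>The bound \<open>c\<close> may be negative; raising it makes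
        \<open>K = 1 / (1 - c')\<close> exceed 1, and a gap of ratio \<open>K\<close> has relative
        length exactly \<open>c'\<close>.\<close>
      define c' where "c' = max c (1/2)"
      have c': "0 < c'" "c' < 1"
        using c(2) by (simp_all add: c'_def)
      note c(1)
      also have "ereal c \<le> ereal c'"
        by (simp add: c'_def)
      finally have "\<forall>\<^sub>F h in at_right 0. ?f h < ereal c'"
        by (rule Limsup_lessD)
      then obtain \<delta> where \<delta>: "\<delta> > 0" "\<And>h. 0 < h \<Longrightarrow> h < \<delta> \<Longrightarrow> max_gap E h / h < c'"
        by (simp only: eventually_at_right_field less_ereal.simps) blast
      define K where "K = 1 / (1 - c')"
      have K: "K > 1" "K - 1 = c' * K"
        using c' by (auto simp: K_def field_simps)
      then obtain a where a: "a > 0" "K * a < \<delta>" "{a<..<K * a} \<inter> E = {}"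
        using gaps \<delta>(1) by blast
      have "K * a - a \<le> max_gap E (K * a)"
        using a K(1) by (intro max_gap_ge) auto
      moreover have "K * a - a = c' * (K * a)"
        using K(2) by (metis left_diff_distrib mult.assoc mult_1)
      ultimately have "c' \<le> max_gap E (K * a) / (K * a)"
        using a K(1) by (simp add: pos_le_divide_eq)
      then show False
        using \<delta>(2)[of "K * a"] a K(1) by simp
    qed
    ultimately show "Limsup (at_right 0) ?f = 1"
      by (simp only: order.antisym not_less)
  qed
  then show ?thesis
    by (auto simp: SP_def)
qed

lemma SP_subset: "A \<in> SP \<Longrightarrow> B \<subseteq> A \<Longrightarrow> B \<in> SP"
  unfolding SP_iff by (meson disjoint_iff subset_iff)

lemma nonneg_reals_notin_SP: "\<real>\<^sub>+ \<notin> SP"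
proof
  assume "\<real>\<^sub>+ \<in> SP"
  then obtain a :: real where "a > 0" "{a<..<2 * a} \<inter> \<real>\<^sub>+ = {}"
    unfolding SP_iff by (metis one_less_numeral_iff semiring_norm(76) zero_less_one)
  moreover have "3 / 2 * a \<in> {a<..<2 * a} \<inter> \<real>\<^sub>+"
    using \<open>a > 0\<close> by simp
  ultimately show False
    by blast
qed

section \<open>Syndetically porous sets in maximal ideals\<close>

definition syndetically_porous :: "real set \<Rightarrow> bool" where
  "syndetically_porous E \<longleftrightarrow> (\<forall>K>1. \<exists>M>1. \<exists>\<delta>>0. \<forall>a>0. M * a < \<delta> \<longrightarrow>
    (\<exists>c\<ge>a. K * c \<le> M * a \<and> {c<..<K * c} \<inter> E = {}))"

lemma syndetically_porous_Un_SP: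
  assumes E: "syndetically_porous E" "E \<subseteq> \<real>\<^sub>+" and "A \<in> SP"
  shows "A \<union> E \<in> SP"
  unfolding SP_iff
proof (intro conjI allI impI)
  show "A \<union> E \<subseteq> \<real>\<^sub>+"
    using assms by (auto simp: SP_def)
next
  fix K \<delta> :: real
  assume "K > 1" "\<delta> > 0"
  obtain M \<delta>' where M: "M > 1" "\<delta>' > 0"
    "\<And>a. a > 0 \<Longrightarrow> M * a < \<delta>' \<Longrightarrow> \<exists>c\<ge>a. K * c \<le> M * a \<and> {c<..<K * c} \<inter> E = {}"
    using E(1) \<open>K > 1\<close> unfolding syndetically_porous_def by metis
  obtain a where a: "a > 0" "M * a < min \<delta> \<delta>'" "{a<..<M * a} \<inter> A = {}"
    using \<open>A \<in> SP\<close> M \<open>\<delta> > 0\<close> unfolding SP_iff by (metis min_less_iff_conj)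
  then obtain c where c: "c \<ge> a" "K * c \<le> M * a" "{c<..<K * c} \<inter> E = {}"
    using M(3)[of a] by auto
  have "{c<..<K * c} \<inter> A = {}"
    using a(3) c by (auto simp: disjoint_iff)
  then show "\<exists>a>0. K * a < \<delta> \<and> {a<..<K * a} \<inter> (A \<union> E) = {}"
    using a c by (intro exI[of _ c]) auto
qed

text \<open>Adjoining \<open>E\<close> to a maximal ideal gives a collection that stays inside
  \<open>SP\<close>. It therefore omits the half-line, is an ideal, and by maximality is the ideal
  itself.\<close>

lemma syndetically_porous_in_I_hat_SP:
  assumes E: "syndetically_porous E" "E \<subseteq> \<real>\<^sub>+"
  shows "E \<in> I_hat_SP"
  unfolding I_hat_SP_def
proof (clarify)
  fix I
  assume I: "SP_maximal I"
  \<comment> \<open>The empty set is added because \<^const>\<open>set_ideal\<close> does not exclude the empty collection.\<close>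
  define J where "J = {B. \<exists>A\<in>insert {} I. B \<subseteq> A \<union> E}"
  have "I \<subseteq> SP" and "set_ideal I"
    using I by (auto simp: SP_maximal_def)
  have "{} \<in> SP"
    unfolding SP_iff
  proof (intro conjI allI impI)
    fix K \<delta> :: real
    assume "K > 1" "\<delta> > 0"
    then show "\<exists>a>0. K * a < \<delta> \<and> {a<..<K * a} \<inter> {} = {}"
      by (intro exI[of _ "\<delta> / (2 * K)"]) auto
  qed auto
  then have "J \<subseteq> SP"
    using \<open>I \<subseteq> SP\<close> syndetically_porous_Un_SP[OF E] SP_subset unfolding J_def by blast
  moreover have "set_ideal J"
    unfolding set_ideal_def
  proof (intro conjI ballI allI impI)
    show "J \<subseteq> Pow \<real>\<^sub>+" "\<real>\<^sub>+ \<notin> J"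
      using \<open>J \<subseteq> SP\<close> nonneg_reals_notin_SP by (auto simp: SP_def)
    show "B \<in> J" if "A \<in> J" "B \<subseteq> A" for A B
      using that unfolding J_def by blast
    show "A \<union> B \<in> J" if AB: "A \<in> J" "B \<in> J" for A B
    proof -
      obtain A' B' where A': "A' \<in> insert {} I" "A \<subseteq> A' \<union> E" "B' \<in> insert {} I" "B \<subseteq> B' \<union> E"
        using AB unfolding J_def by blast
      then have "A' \<union> B' \<in> insert {} I"
        using \<open>set_ideal I\<close> unfolding set_ideal_def by auto
      moreover have "A \<union> B \<subseteq> (A' \<union> B') \<union> E"
        using A'(2,4) by blast
      ultimately show ?thesis
        unfolding J_def by blast
    qed
  qed
  moreover have "I \<subseteq> J"
    unfolding J_def by blast
  ultimately have "I = J"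
    using I by (simp add: SP_maximal_def)
  moreover have "E \<in> J"
    unfolding J_def by blast
  ultimately show "E \<in> I"
    by simp
qed

lemma finite_unions_subset_I_hat_SP:
  assumes "\<A> \<subseteq> I_hat_SP"
  shows "finite_unions \<A> \<subseteq> I_hat_SP"
proof
  fix E
  assume "E \<in> finite_unions \<A>"
  then obtain n and A :: "nat \<Rightarrow> real set"
    where n: "n \<ge> 1" "\<forall>i\<in>{1..n}. A i \<in> \<A>" "E = (\<Union>i\<in>{1..n}. A i)"
    unfolding finite_unions_def by blast
  show "E \<in> I_hat_SP"
    unfolding I_hat_SP_def
  proof clarify
    fix I
    assume I: "SP_maximal I"
    then have Un: "X \<union> Y \<in> I" if "X \<in> I" "Y \<in> I" for X Y
      using that by (auto simp: SP_maximal_def set_ideal_def)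
    have A: "A i \<in> I" if "i \<in> {1..n}" for i
      using assms n(2) that I unfolding I_hat_SP_def by blast
    \<comment> \<open>The induction starts at singletons, where membership in \<open>I\<close> comes
      from \<open>A\<close>; \<open>set_ideal\<close> does not assert that the empty set is in
      \<open>I\<close>.\<close>
    have "(\<Union>i\<in>F. A i) \<in> I" if "finite F" "F \<noteq> {}" "F \<subseteq> {1..n}" for F
      using that by (induction F rule: finite_ne_induct) (simp_all add: A Un)
    then have "(\<Union>i\<in>{1..n}. A i) \<in> I"
      using n(1) by simp
    then show "E \<in> I"
      using n(3) by simp
  qed
qed

section \<open>Cluster structure of completely strongly porous sets\<close>

text \<open>The bound \<open>q\<close> on the cluster ratio is chosen before
  \<open>\<epsilon>\<close>. If no \<open>q\<close> works, bad points for all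
  \<open>q = k + 2\<close> are merged into one sequence; a comparable gap sequence has gaps so wide
  that one of them contains a point of \<open>E\<close>.\<close>

lemma CSP_gaps:
  assumes "E \<in> CSP"
  shows "\<exists>q>1. \<forall>\<epsilon>>0. \<exists>\<delta>>0. \<forall>x\<in>E. 0 < x \<and> x < \<delta> \<longrightarrow> {\<epsilon> * x<..<x / q} \<inter> E = {}"
proof (rule ccontr)
  assume no_q: "\<not> ?thesis"
  have "\<exists>\<epsilon>>0. \<forall>\<delta>>0. \<exists>x\<in>E. 0 < x \<and> x < \<delta> \<and> {\<epsilon> * x<..<x / (real k + 2)} \<inter> E \<noteq> {}" for k
  proof -
    have "real k + 2 > 1"
      by simp
    then show ?thesis
      using no_q by meson
  qed
  then obtain \<epsilon> where \<epsilon>: "\<And>k. \<epsilon> k > 0"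
    "\<And>k \<delta>. \<delta> > 0 \<Longrightarrow> \<exists>x\<in>E. 0 < x \<and> x < \<delta> \<and> {\<epsilon> k * x<..<x / (real k + 2)} \<inter> E \<noteq> {}"
    by metis
  \<comment> \<open>The bad points for every \<open>k\<close> must occur infinitely often in a single sequence.\<close>
  define \<kappa> where "\<kappa> n = fst (prod_decode n)" for n
  define P where "P n x \<longleftrightarrow> x \<in> E \<and> 0 < x \<and> x < 1 / Suc n \<and>
    {\<epsilon> (\<kappa> n) * x<..<x / (real (\<kappa> n) + 2)} \<inter> E \<noteq> {}" for n x
  have "\<exists>\<tau>. \<forall>n. P n (\<tau> n) \<and> \<tau> (Suc n) \<le> \<tau> n"
  proof (rule dependent_nat_choice)
    show "\<exists>x. P 0 x"
      using \<epsilon>(2)[of 1 "\<kappa> 0"] by (auto simp: P_def)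
    show "\<exists>y. P (Suc n) y \<and> y \<le> x" if "P n x" for n x
    proof -
      have "min x (1 / Suc (Suc n)) > 0"
        using that by (simp add: P_def)
      from \<epsilon>(2)[OF this, of "\<kappa> (Suc n)"] show ?thesis
        by (force simp: P_def)
    qed
  qed
  then obtain \<tau> where \<tau>: "\<And>n. P n (\<tau> n)" "\<And>n. \<tau> (Suc n) \<le> \<tau> n"
    by blast
  have "\<tau> \<longlonglongrightarrow> 0"
  proof (rule tendsto_sandwich[where f = "\<lambda>_. 0"])
    show "(\<lambda>n. 1 / real (Suc n)) \<longlonglongrightarrow> 0"
      using LIMSEQ_inverse_real_of_nat by (simp add: inverse_eq_divide)
    show "\<forall>\<^sub>F n in sequentially. \<tau> n \<le> 1 / real (Suc n)"
      using \<tau>(1) by (auto simp: P_def intro!: always_eventually less_imp_le)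
    show "\<forall>\<^sub>F n in sequentially. 0 \<le> \<tau> n"
      using \<tau>(1) by (auto simp: P_def intro!: always_eventually less_imp_le)
  qed auto
  then have "\<tau> \<in> seqs_in E"
    using \<tau> by (auto simp: seqs_in_def decreasing_null_def P_def decseq_Suc_iff)
      (metis less_irrefl)
  then obtain h where "h \<in> gap_seqs E" "seq_asymp \<tau> h"
    using assms unfolding CSP_def by blast
  then obtain c1 c2 where h: "\<And>n. h n > 0" "(\<lambda>n. max_gap E (h n) / h n) \<longlonglongrightarrow> 1"
    and c: "c1 > 0" "c2 > 0" "\<And>n. c1 * \<tau> n \<le> h n" "\<And>n. h n \<le> c2 * \<tau> n"
    unfolding gap_seqs_def decreasing_null_def seq_asymp_def by blast
  \<comment> \<open>This \<open>k\<close> puts \<open>\<tau> n / (k + 2)\<close> below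
    \<open>h n / 2\<close>, and \<open>\<eta>\<close> makes the gap \<open>(u, v)\<close> start
    below \<open>\<epsilon> k * \<tau> n\<close> and end beyond \<open>h n / 2\<close>; so the bad
    point \<open>z\<close> falls into it.\<close>
  obtain k :: nat where k: "2 / c1 \<le> real k"
    using real_arch_simple by blast
  define \<eta> where "\<eta> = min (1 / 2) (\<epsilon> k / c2)"
  have \<eta>: "0 < \<eta>" "\<eta> \<le> 1 / 2" "\<eta> * c2 \<le> \<epsilon> k"
    using \<epsilon>(1)[of k] c by (auto simp: \<eta>_def min_def field_simps)
  have "\<forall>\<^sub>F n in sequentially. max_gap E (h n) / h n > 1 - \<eta>"
    using order_tendstoD(1)[OF h(2)] \<eta>(1) by simp
  then obtain N where N: "\<And>n. n \<ge> N \<Longrightarrow> max_gap E (h n) / h n > 1 - \<eta>"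
    unfolding eventually_sequentially by blast
  \<comment> \<open>An encoded pair is at least its second component, so this index is beyond
    \<open>N\<close> and still has label \<open>k\<close>.\<close>
  define n where "n = prod_encode (k, N)"
  have "n \<ge> N" and \<kappa>n: "\<kappa> n = k"
    unfolding n_def \<kappa>_def by (auto simp: le_prod_encode_2)
  have "max_gap E (h n) > (1 - \<eta>) * h n"
    using N[OF \<open>n \<ge> N\<close>] h(1)[of n] by (simp add: field_simps)
  then obtain u v where uv: "0 \<le> u" "v \<le> h n" "{u<..<v} \<inter> E = {}" "v - u > (1 - \<eta>) * h n"
    using max_gap_attained[OF h(1)[of n], of E] by metis
  obtain z where z: "z \<in> E" "\<epsilon> k * \<tau> n < z" "z < \<tau> n / (real k + 2)"
    using \<tau>(1)[of n] unfolding P_def \<kappa>n by auto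
  have "\<tau> n > 0"
    using \<tau>(1)[of n] by (simp add: P_def)
  have "u < \<eta> * h n"
    using uv by (simp add: algebra_simps)
  also have "\<dots> \<le> \<eta> * (c2 * \<tau> n)"
    using \<eta> c(4) by (intro mult_left_mono) auto
  also have "\<dots> \<le> \<epsilon> k * \<tau> n"
    using \<eta>(3) \<open>\<tau> n > 0\<close> by (simp flip: mult.assoc)
  also note z(2)
  finally have "u < z" .
  have "2 \<le> c1 * (real k + 2)"
    using k c(1) by (simp add: field_simps add_increasing)
  then have "2 * \<tau> n \<le> c1 * (real k + 2) * \<tau> n"
    using \<open>\<tau> n > 0\<close> by (intro mult_right_mono) auto
  also have "\<dots> = (real k + 2) * (c1 * \<tau> n)"
    by simp
  also have "\<dots> \<le> (real k + 2) * h n"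
    by (intro mult_left_mono c(3)) auto
  finally have "\<tau> n / (real k + 2) \<le> h n / 2"
    by (simp add: field_simps)
  moreover have "h n / 2 \<le> (1 - \<eta>) * h n"
    using \<eta>(2) h(1)[of n] mult_right_mono[of "1/2" "1 - \<eta>" "h n"] by simp
  ultimately have "z < v"
    using z(3) uv by linarith
  with \<open>u < z\<close> uv(3) z(1) show False
    by auto
qed

lemma CSP_syndetically_porous:
  assumes "E \<in> CSP"
  shows "syndetically_porous E"
  unfolding syndetically_porous_def
proof (intro allI impI)
  fix K :: real
  assume K: "K > 1"
  obtain q where q: "q > 1"
    "\<And>\<epsilon>. \<epsilon> > 0 \<Longrightarrow> \<exists>\<delta>>0. \<forall>x\<in>E. 0 < x \<and> x < \<delta> \<longrightarrow> {\<epsilon> * x<..<x / q} \<inter> E = {}"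
    using CSP_gaps[OF assms] by metis
  \<comment> \<open>With this \<open>\<epsilon>\<close>, a point \<open>x\<close> of
    \<open>E\<close> in the upper part \<open>(q * K * a, q * K * K * a)\<close> of the window has
    the gap \<open>(x / (q * K), x / q)\<close> of ratio \<open>K\<close> below it; without such a
    point the upper part is itself a gap of ratio \<open>K\<close>.\<close>
  have "1 / (q * K) > 0"
    using q K by simp
  from q(2)[OF this] obtain \<delta>
    where \<delta>: "\<delta> > 0" "\<And>x. x \<in> E \<Longrightarrow> 0 < x \<Longrightarrow> x < \<delta> \<Longrightarrow> {1 / (q * K) * x<..<x / q} \<inter> E = {}"
    by blast
  have qK: "q * K > 1" "q * K * K > 1"
    using q(1) K by (simp_all add: less_1_mult)
  have "\<exists>c\<ge>a. K * c \<le> q * K * K * a \<and> {c<..<K * c} \<inter> E = {}"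
    if a: "a > 0" "q * K * K * a < \<delta>" for a
  proof (cases "\<exists>x\<in>E. q * K * a < x \<and> x < q * K * K * a")
    case True
    then obtain x where x: "x \<in> E" "q * K * a < x" "x < q * K * K * a"
      by blast
    have "0 < x"
      using x(2) a qK(1) by (smt (verit) mult_pos_pos)
    have "a \<le> x / (q * K)"
      using x(2) qK(1) by (simp add: pos_le_divide_eq mult.commute)
    moreover have "K * (x / (q * K)) = x / q"
      using K by simp
    moreover have "x / q \<le> q * K * K * a"
      using x(3) q(1) \<open>0 < x\<close> by (smt (verit) divide_le_eq_1 frac_less2 div_by_1)
    moreover have "{x / (q * K)<..<x / q} \<inter> E = {}"
      using \<delta>(2)[of x] x a \<open>0 < x\<close> by simp
    ultimately show ?thesis
      by (metis (no_types, lifting))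
  next
    case False
    have "a \<le> q * K * a"
      using a(1) qK(1) by simp
    moreover have "{q * K * a<..<K * (q * K * a)} \<inter> E = {}"
      using False by (auto simp: mult_ac)
    ultimately show ?thesis
      by (intro exI[of _ "q * K * a"]) (auto simp: mult_ac)
  qed
  then show "\<exists>M>1. \<exists>\<delta>>0. \<forall>a>0. M * a < \<delta> \<longrightarrow>
    (\<exists>c\<ge>a. K * c \<le> M * a \<and> {c<..<K * c} \<inter> E = {})"
    using qK(2) \<delta>(1) by blast
qed

section \<open>The union of sparse progressions\<close>

text \<open>
  \<^const>\<open>prod_decode\<close> is used because its first component takes every value infinitely often and
  is at most \<open>j\<close>: the \<open>j\<close>-th progression then ends by \<open>j ^ 3 + j ^ 2\<close>, far from \<open>(j + 1) ^ 3\<close>.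
\<close>

definition prog_diff :: "nat \<Rightarrow> nat" where
  "prog_diff j = fst (prod_decode j)"

definition prog_union :: "nat set" where
  "prog_union = {j ^ 3 + i * prog_diff j | i j. i \<le> prog_diff j}"

definition prog_set :: "real set" where
  "prog_set = (\<lambda>s. (1 / 2) ^ s) ` prog_union"

lemma prog_diff_le: "prog_diff j \<le> j"
  unfolding prog_diff_def
  by (metis le_prod_encode_1 prod.collapse prod_decode_inverse)

lemma prog_point_le:
  assumes "i \<le> prog_diff j"
  shows "j ^ 3 + i * prog_diff j \<le> j ^ 3 + j ^ 2"
  using mult_le_mono[of i j "prog_diff j" j] assms prog_diff_le[of j] by (simp add: power2_eq_square)

text \<open>Within one progression the difference separates the terms. Earlier progressions end by
  \<open>l ^ 3 + l ^ 2\<close> with \<open>l = j - 1\<close>, at least \<open>j\<close> before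
  \<open>j ^ 3\<close>. Later ones start too far out to contain \<open>s'\<close>.\<close>

lemma prog_union_gap:
  assumes s: "s = j ^ 3 + i * prog_diff j" "i \<le> prog_diff j"
    and "i = 0 \<or> k \<le> prog_diff j" "k \<le> j" "s' \<in> prog_union" "s' < s"
  shows "s' + k \<le> s"
proof -
  obtain i' j' where s': "s' = j' ^ 3 + i' * prog_diff j'" "i' \<le> prog_diff j'"
    using \<open>s' \<in> prog_union\<close> unfolding prog_union_def by blast
  note le = prog_point_le[OF s(2)] prog_point_le[OF s'(2)]
  consider "j' < j" | "j' = j" | "j < j'"
    by linarith
  then show ?thesis
  proof cases
    case 1
    then obtain l where l: "j = Suc l" "j' \<le> l"
      by (metis Suc_le_mono less_iff_Suc_add less_Suc_eq_le le_add1)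
    have "s' \<le> l ^ 3 + l ^ 2"
      using le(2) s'(1) power_mono[OF l(2), of 3] power_mono[OF l(2), of 2] by linarith
    moreover have "l ^ 3 + l ^ 2 + j \<le> j ^ 3"
      unfolding l by (simp add: power3_eq_cube power2_eq_square algebra_simps)
    ultimately show ?thesis
      using s(1) \<open>k \<le> j\<close> by linarith
  next
    case 2
    then have "i' < i"
      using s(1) s'(1) \<open>s' < s\<close> by (metis add_less_cancel_left mult_less_cancel2)
    then have "Suc i' * prog_diff j \<le> i * prog_diff j" "k \<le> prog_diff j"
      using assms(3) mult_le_mono1[of "Suc i'" i] by auto
    then show ?thesis
      using s(1) s'(1) 2 by simp
  next
    case 3
    have "j ^ 3 + j ^ 2 \<le> Suc j ^ 3"
      by (simp add: power3_eq_cube power2_eq_square algebra_simps)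
    also have "\<dots> \<le> s'"
      using power_mono[of "Suc j" j' 3] 3 s'(1) by linarith
    finally show ?thesis
      using le(1) s(1) \<open>s' < s\<close> by linarith
  qed
qed

text \<open>The map from \<open>s\<close> to \<open>(1 / 2) ^ s\<close> reverses order, so a gap of
  length \<open>k\<close> below the exponent \<open>s\<close> becomes a gap of ratio
  \<open>2 ^ k\<close> above the point.\<close>

lemma prog_set_gap:
  assumes "s = j ^ 3 + i * prog_diff j" "i \<le> prog_diff j"
    and "i = 0 \<or> k \<le> prog_diff j" "k \<le> j"
  shows "{(1 / 2) ^ s<..<2 ^ k * (1 / 2) ^ s} \<inter> prog_set = {}"
proof (rule ccontr)
  assume "\<not> ?thesis"
  then obtain s' where s': "s' \<in> prog_union" "(1 / 2 :: real) ^ s < (1 / 2) ^ s'"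
    "(1 / 2 :: real) ^ s' < 2 ^ k * (1 / 2) ^ s"
    unfolding prog_set_def by auto
  have "s' < s"
    using s'(2) by (rule contrapos_pp) (auto simp: not_less intro: power_decreasing)
  then have "s' + k \<le> s"
    using prog_union_gap assms s'(1) by blast
  then have "(1 / 2 :: real) ^ s \<le> (1 / 2) ^ (s' + k)"
    by (intro power_decreasing) auto
  then have "2 ^ k * (1 / 2 :: real) ^ s \<le> (1 / 2) ^ s'"
    by (simp add: power_add power_one_over field_simps)
  with s'(3) show False
    by simp
qed

lemma prog_set_syndetically_porous: "syndetically_porous prog_set"
  unfolding syndetically_porous_def
proof (intro allI impI)
  fix K :: real
  assume K: "K > 1"
  obtain k :: nat where k: "K < 2 ^ k"
    using real_arch_pow[of 2 K] by auto
  \<comment> \<open>One factor \<open>K\<close> is for locating a point in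
    \<open>(a, K * a)\<close>, the power of 2 for moving back to the first term of a progression of
    difference below \<open>k\<close>, and the other \<open>K\<close> for the gap itself.\<close>
  define M where "M = K * (2 ^ (k * k) * K)"
  \<comment> \<open>All points of the progressions with index below \<open>k\<close> are at least
    this large, which forces \<open>k \<le> j\<close> below.\<close>
  define \<delta> :: real where "\<delta> = (1 / 2) ^ (k ^ 3 + k ^ 2)"
  have "1 \<le> (2 :: real) ^ (k * k)"
    by simp
  then have "K \<le> 2 ^ (k * k) * K"
    using K mult_right_mono[of 1 "2 ^ (k * k)" K] by simp
  then have "1 < 2 ^ (k * k) * K"
    using K by linarith
  then have MK: "K < M"
    using K mult_strict_left_mono[of 1 "2 ^ (k * k) * K" K] by (simp add: M_def)
  have "\<exists>c\<ge>a. K * c \<le> M * a \<and> {c<..<K * c} \<inter> prog_set = {}" if a: "a > 0" "M * a < \<delta>" for a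
  proof (cases "{a<..<K * a} \<inter> prog_set = {}")
    case True
    then show ?thesis
      using a MK by (intro exI[of _ a]) auto
  next
    case False
    then obtain i j where x: "a < (1 / 2) ^ (j ^ 3 + i * prog_diff j)"
      "(1 / 2) ^ (j ^ 3 + i * prog_diff j) < K * a" and i: "i \<le> prog_diff j"
      unfolding prog_set_def prog_union_def by auto
    have "k \<le> j"
    proof (rule ccontr)
      assume "\<not> k \<le> j"
      then have "j ^ 3 + i * prog_diff j \<le> k ^ 3 + k ^ 2"
        using prog_point_le[OF i] power_mono[of j k 3] power_mono[of j k 2] by linarith
      then have "\<delta> \<le> (1 / 2) ^ (j ^ 3 + i * prog_diff j)"
        unfolding \<delta>_def by (intro power_decreasing) auto
      also note x(2)
      also have "K * a \<le> M * a"
        using a MK by simp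
      finally show False
        using a by simp
    qed
    \<comment> \<open>The gap begins at the point found if its progression has large difference, and otherwise at the
      first term of that progression.\<close>
    define i' where "i' = (if k \<le> prog_diff j then i else 0)"
    define c :: real where "c = (1 / 2) ^ (j ^ 3 + i' * prog_diff j)"
    have "{c<..<2 ^ k * c} \<inter> prog_set = {}"
      unfolding c_def by (rule prog_set_gap[OF refl _ _ \<open>k \<le> j\<close>]) (auto simp: i'_def i)
    moreover have "c > 0"
      by (simp add: c_def)
    ultimately have gap: "{c<..<K * c} \<inter> prog_set = {}"
      using k by (fastforce simp: disjoint_iff intro: less_trans)
    have "(1 / 2) ^ (j ^ 3 + i * prog_diff j) \<le> c"
      unfolding c_def by (intro power_decreasing) (auto simp: i'_def)
    then have "a \<le> c"
      using x(1) by simp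
    have "i * prog_diff j \<le> i' * prog_diff j + k * k"
      using i mult_le_mono[of i k "prog_diff j" k] by (auto simp: i'_def)
    then have "(1 / 2 :: real) ^ (j ^ 3 + i' * prog_diff j + k * k) \<le> (1 / 2) ^ (j ^ 3 + i * prog_diff j)"
      by (intro power_decreasing) auto
    then have "c \<le> 2 ^ (k * k) * (1 / 2) ^ (j ^ 3 + i * prog_diff j)"
      unfolding c_def by (simp add: power_add power_one_over field_simps)
    also have "\<dots> \<le> 2 ^ (k * k) * (K * a)"
      using x(2) by (intro mult_left_mono) auto
    finally have "K * c \<le> M * a"
      using K by (simp add: M_def mult.assoc)
    then show ?thesis
      using gap \<open>a \<le> c\<close> by blast
  qed
  moreover have "M > 1" "\<delta> > 0"
    using K MK by (auto simp: \<delta>_def)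
  ultimately show "\<exists>M>1. \<exists>\<delta>>0. \<forall>a>0. M * a < \<delta> \<longrightarrow>
    (\<exists>c\<ge>a. K * c \<le> M * a \<and> {c<..<K * c} \<inter> prog_set = {})"
    by blast
qed

section \<open>Separation from finite unions of CSP sets\<close>

lemma prog_set_notin_I_CSP: "prog_set \<notin> I_CSP"
proof
  assume "prog_set \<in> I_CSP"
  then obtain n and A :: "nat \<Rightarrow> real set"
    where A: "\<And>l. l \<in> {1..n} \<Longrightarrow> A l \<in> CSP" "prog_set = (\<Union>l\<in>{1..n}. A l)"
    unfolding I_CSP_def finite_unions_def by blast
  have "\<exists>q>1. \<forall>\<epsilon>>0. \<exists>\<delta>>0. \<forall>x\<in>A l. 0 < x \<and> x < \<delta> \<longrightarrow> {\<epsilon> * x<..<x / q} \<inter> A l = {}"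
    if "l \<in> {1..n}" for l
    using CSP_gaps[OF A(1)[OF that]] .
  then obtain q where q: "\<And>l. l \<in> {1..n} \<Longrightarrow> q l > 1"
    "\<And>l \<epsilon>. l \<in> {1..n} \<Longrightarrow> \<epsilon> > 0 \<Longrightarrow>
      \<exists>\<delta>>0. \<forall>x\<in>A l. 0 < x \<and> x < \<delta> \<longrightarrow> {\<epsilon> * x<..<x / q l} \<inter> A l = {}"
    by metis
  have "\<exists>L::nat. \<forall>l\<in>{1..n}. q l < 2 ^ L"
  proof -
    obtain L :: nat where L: "(\<Sum>l\<in>{1..n}. q l) < 2 ^ L"
      using real_arch_pow[of 2] by auto
    have "q l \<le> (\<Sum>l\<in>{1..n}. q l)" if "l \<in> {1..n}" for l
      using that q(1) by (intro member_le_sum) (auto intro: less_imp_le less_trans[OF zero_less_one])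
    then show ?thesis
      using L by (meson le_less_trans)
  qed
  then obtain L :: nat where L: "\<And>l. l \<in> {1..n} \<Longrightarrow> q l < 2 ^ L"
    by blast
  \<comment> \<open>The summand \<open>n\<close> gives more terms than sets for the pigeonhole
    principle; \<open>L\<close> makes the ratio of two distinct terms exceed every
    \<open>q l\<close>.\<close>
  define m where "m = n + L"
  \<comment> \<open>The whole progression spans the ratio \<open>2 ^ (m * m)\<close>;
    \<open>Suc\<close> makes the comparison with \<open>\<epsilon>\<close> strict.\<close>
  define \<epsilon> :: real where "\<epsilon> = (1 / 2) ^ Suc (m * m)"
  have "\<epsilon> > 0"
    by (simp add: \<epsilon>_def)
  have "\<exists>\<delta>>0. \<forall>x\<in>A l. 0 < x \<and> x < \<delta> \<longrightarrow> {\<epsilon> * x<..<x / q l} \<inter> A l = {}"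
    if "l \<in> {1..n}" for l
    using q(2)[OF that \<open>\<epsilon> > 0\<close>] .
  then obtain d where d: "\<And>l. l \<in> {1..n} \<Longrightarrow> d l > 0"
    "\<And>l x. l \<in> {1..n} \<Longrightarrow> x \<in> A l \<Longrightarrow> 0 < x \<Longrightarrow> x < d l \<Longrightarrow> {\<epsilon> * x<..<x / q l} \<inter> A l = {}"
    by metis
  \<comment> \<open>Inserting 1 keeps the set nonempty also for \<open>n = 0\<close>.\<close>
  define \<delta> where "\<delta> = Min (insert 1 (d ` {1..n}))"
  have \<delta>: "\<delta> > 0" "\<And>l. l \<in> {1..n} \<Longrightarrow> \<delta> \<le> d l"
    unfolding \<delta>_def using d(1) by (subst Min_gr_iff) (auto simp del: Min_insert)
  obtain J :: nat where J: "(1 / 2) ^ J < \<delta>"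
    using real_arch_pow_inv[of \<delta> "1 / 2"] \<delta>(1) by auto
  \<comment> \<open>This picks a progression of difference \<open>m\<close> far enough out that all
    its points lie below \<open>\<delta>\<close>.\<close>
  define j where "j = prod_encode (m, J)"
  have j: "prog_diff j = m" "J \<le> j"
    by (auto simp: j_def prog_diff_def le_prod_encode_2)
  define x :: "nat \<Rightarrow> real" where "x i = (1 / 2) ^ (j ^ 3 + i * m)" for i
  have "\<exists>l\<in>{1..n}. x i \<in> A l" if "i \<in> {0..m}" for i
  proof -
    have "x i \<in> prog_set"
      using that j(1) unfolding x_def prog_set_def prog_union_def by fastforce
    then show ?thesis
      using A(2) by blast
  qed
  then obtain f where f: "\<And>i. i \<in> {0..m} \<Longrightarrow> f i \<in> {1..n}" "\<And>i. i \<in> {0..m} \<Longrightarrow> x i \<in> A (f i)"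
    by metis
  have "f ` {0..m} \<subseteq> {1..n}"
    using f(1) by blast
  then have "card (f ` {0..m}) \<le> n"
    using card_mono[of "{1..n}"] by fastforce
  then have "\<not> inj_on f {0..m}"
    by (intro pigeonhole) (auto simp: m_def)
  then obtain i i' where i: "i < i'" "i' \<le> m" "f i = f i'"
    unfolding inj_on_def by (metis atLeastAtMost_iff linorder_neqE_nat)
  define l where "l = f i"
  have l: "l \<in> {1..n}" "x i \<in> A l" "x i' \<in> A l"
    using i f(1)[of i] f(2)[of i] f(2)[of i'] by (auto simp: l_def)
  have "J \<le> j ^ 3 + i * m"
    using j(2) self_le_power[of j 3] by (cases "j = 0") auto
  then have "x i \<le> (1 / 2) ^ J"
    unfolding x_def by (intro power_decreasing) auto
  then have "x i < d l"
    using J \<delta>(2)[OF l(1)] by linarith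
  moreover have "0 < x i"
    by (simp add: x_def)
  ultimately have gap: "{\<epsilon> * x i<..<x i / q l} \<inter> A l = {}"
    using d(2) l by blast
  obtain r where r: "i' = i + r" "1 \<le> r" "r \<le> m"
    using i by (metis add_leD2 less_iff_Suc_add add_Suc_right le_add2 plus_1_eq_Suc
        le_add1 nat_less_le less_imp_add_positive Suc_leI One_nat_def)
  have xi': "x i' = (1 / 2) ^ (r * m) * x i"
    unfolding x_def r by (simp add: power_add algebra_simps)
  have "m \<le> r * m"
    using r by simp
  then have "r * m \<le> m * m" "L \<le> r * m"
    using r m_def by (simp, linarith)
  have "\<epsilon> < (1 / 2) ^ (r * m)"
    unfolding \<epsilon>_def by (intro power_strict_decreasing le_imp_less_Suc \<open>r * m \<le> m * m\<close>) auto
  then have "\<epsilon> * x i < x i'"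
    unfolding xi' using \<open>0 < x i\<close> by (intro mult_strict_right_mono)
  moreover have "x i' < x i / q l"
  proof -
    have "(1 / 2 :: real) ^ (r * m) \<le> (1 / 2) ^ L"
      using \<open>L \<le> r * m\<close> by (intro power_decreasing) auto
    also have "\<dots> < 1 / q l"
      using L[OF l(1)] q(1)[OF l(1)] by (simp add: power_one_over frac_less2)
    finally show ?thesis
      unfolding xi' using \<open>0 < x i\<close> mult_strict_right_mono by fastforce
  qed
  ultimately show False
    using gap l(3) by auto
qed

theorem mainTheorem4:
  shows "I_CSP \<subseteq> I_hat_SP \<and> (\<exists>E. E \<subseteq> \<real>\<^sub>+ \<and> E \<in> I_hat_SP \<and> E \<notin> I_CSP)"
proof
  have "CSP \<subseteq> I_hat_SP"
    using CSP_syndetically_porous syndetically_porous_in_I_hat_SP by (auto simp: CSP_def)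
  then show "I_CSP \<subseteq> I_hat_SP"
    unfolding I_CSP_def by (rule finite_unions_subset_I_hat_SP)
  have "prog_set \<subseteq> \<real>\<^sub>+"
    by (auto simp: prog_set_def)
  then show "\<exists>E. E \<subseteq> \<real>\<^sub>+ \<and> E \<in> I_hat_SP \<and> E \<notin> I_CSP"
    using prog_set_syndetically_porous syndetically_porous_in_I_hat_SP prog_set_notin_I_CSP by blast
qed

end
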